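(* Let $S$ be a symmetry group in dimension $d$, let $(G,p)\in\mathscr{R}_{(G,S)}$ be a framework in $\mathbb{E}^d$ with $n$ joints, and let $q$ be a configuration of $n$ points in the whole sphere $\mathbb{S}^{d}$ such that $(G,q)$ has symmetry group $S^*$ and such that the projection $\pi(q)$ from the origin is equal to $p \in \mathbb{E}^{dn}$. Then: (i) the space of $S$-symmetric infinitesimal motions of $(G,p)$ in $\mathbb{E}^{d}$ is isomorphic to the space of $S^{*}$-symmetric infinitesimal motions of $(G,q)$ in $\mathbb{S}^{d}$; (ii) the space of $S$-symmetric trivial infinitesimal motions of $(G,p)$ in $\mathbb{E}^{d}$ is isomorphic to the space of $S^{*}$-symmetric trivial infinitesimal motions of $(G,q)$ in $\mathbb{S}^{d}$; (iii) $(G,p)$ has a non-trivial $S$-symmetric infinitesimal motion in $\mathbb{E}^{d}$ if and only if $(G,q)$ has a non-trivial $S^{*}$-symmetric infinitesimal motion in $\mathbb{S}^{d}$; (iv) the space of $S$-symmetric self-stresses of $(G,p)$ in $\mathbb{E}^{d}$ is isomorphic to the space of $S^{*}$-symmetric self-stresses of $(G,q)$ in $\mathbb{S}^{d}$.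
   Context: A framework $(G,p)$ in $\mathbb{E}^d$ is a finite simple graph $G$ with vertex set $V(G)=\{1,\dots,n\}$ and edge set $E(G)$, together with an injective map $p:V(G)\to\mathbb{E}^d$; $p_i=p(i)$. An infinitesimal motion of $(G,p)$ is a map $u:V(G)\to\mathbb{E}^d$ with $(p_i-p_j)\cdot(u_i-u_j)=0$ for all $\{i,j\}\in E(G)$. It is trivial if $u_i=Ap_i+t$ for all $i$, for some skew-symmetric matrix $A$ and vector $t$; otherwise non-trivial. A self-stress is a function $\omega:E(G)\to\mathbb{R}$ with $\sum_{j:\{i,j\}\in E(G)}\omega_{ij}(p_i-p_j)=0$ for every vertex $i$. A symmetry group in dimension $d$ is a subgroup $S$ of the orthogonal group $O(\mathbb{E}^d)$. $\mathscr{R}_{(G,S)}$ is the set of frameworks $(G,p)$ in $\mathbb{E}^d$ for which there is a map $\Phi:S\to\mathrm{Aut}(G)$ with $x(p_i)=p_{\Phi(x)(i)}$ for all $i\in V(G)$, $x\in S$ (since $p$ is injective, $\Phi$ is unique and a homomorphism); write $x(i)$ for $\Phi(x)(i)$. An infinitesimal motion $u$ is $S$-symmetric if $x(u_i)=u_{x(i)}$ for all $i$ and all $x\in S$. A self-stress is $S$-symmetric if it is constant on the orbits of edges under $S$. For $x\in S$ with matrix $M_x$, $x^*$ is the orthogonal transformation of $\mathbb{E}^{d+1}$ with matrix $\begin{pmatrix}M_x&0\\0&1\end{pmatrix}$, and $S^*=\{x^*:x\in S\}$. $\mathbb{S}^d$ is the unit sphere centered at the origin in $\mathbb{E}^{d+1}$.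 The condition $\pi(q)=p$ means that for each $i$ there is a scalar $\alpha_i\ne0$ (of either sign) with $q_i=\alpha_i(p_i,1)$, i.e. projecting from the origin onto the hyperplane $x_{d+1}=1$ and then back to $\mathbb{E}^d$ gives $p$. A framework $(G,q)$ on the sphere is modelled as the cone framework $(G*o,q)$ in $\mathbb{E}^{d+1}$, where $G*o$ is $G$ with a new vertex $o$ joined to all vertices of $G$ and $o$ is placed at the origin. Thus $(G,q)$ has symmetry group $S^*$ if $(G*o,q)\in\mathscr{R}_{(G*o,S^* )}$; infinitesimal motions of $(G,q)$ on the sphere are the infinitesimal motions of $(G*o,q)$ in $\mathbb{E}^{d+1}$ with $u_o=0$ (so $u_i\cdot q_i=0$ for all $i$), trivial ones being those of the form $u_i=Aq_i$ with $A$ skew-symmetric; self-stresses of $(G,q)$ on the sphere are the self-stresses of $(G*o,q)$; such an infinitesimal motion $u$ is $S^*$-symmetric if $x^*(u_i)=u_{x^*(i)}$ for all vertices $i$ of $G*o$ and all $x^*\in S^*$, where $x^*(i)$ is the vertex of $G*o$ with $x^*(q_i)=q_{x^*(i)}$, and such a self-stress is $S^*$-symmetric if it is constant on the orbits of edges of $G*o$ under $S^*$. *)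

theory Defs
  imports "HOL-Analysis.Analysis" "HOL-Algebra.Group"
begin

text \<open>
  Conventions. The space E^d is \<open>real ^ 'd\<close>, and E^(d+1) is \<open>real ^ 'd option\<close>, where
  \<open>None\<close> indexes the additional last coordinate. The vertex set of a graph is a whole finite
  type \<open>'n\<close>, so that \<open>n = CARD('n)\<close>, configurations and motions are elements of
  \<open>(real ^ 'd) ^ 'n\<close>, and a graph is given by its set of edges.
\<close>

section \<open>Symmetry groups\<close>

definition orthogonal_group :: "('a::euclidean_space \<Rightarrow> 'a) monoid" where
  "orthogonal_group = \<lparr>carrier = {f. orthogonal_transformation f}, mult = (\<circ>), one = id\<rparr>"

lemma group_orthogonal_group: "group (orthogonal_group :: ('a::euclidean_space \<Rightarrow> 'a) monoid)"
proof (rule groupI)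
  fix x :: "'a \<Rightarrow> 'a" assume "x \<in> carrier orthogonal_group"
  then have "orthogonal_transformation x"
    by (simp add: orthogonal_group_def)
  then have "orthogonal_transformation (inv_into UNIV x)" "inv_into UNIV x \<circ> x = id"
    by (simp_all add: orthogonal_transformation_inv orthogonal_transformation_inj)
  then show "\<exists>y\<in>carrier orthogonal_group. y \<otimes>\<^bsub>orthogonal_group\<^esub> x = \<one>\<^bsub>orthogonal_group\<^esub>"
    by (auto simp: orthogonal_group_def)
qed (auto simp: orthogonal_group_def orthogonal_transformation_compose id_def o_assoc)

definition symmetry_group :: "('a::euclidean_space \<Rightarrow> 'a) set \<Rightarrow> bool" where
  "symmetry_group S \<longleftrightarrow> subgroup S orthogonal_group"

section \<open>Frameworks\<close>

definition simple_graph :: "'n set set \<Rightarrow> bool" where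
  "simple_graph E \<longleftrightarrow> (\<forall>e\<in>E. card e = 2)"

definition graph_aut :: "'n set set \<Rightarrow> ('n \<Rightarrow> 'n) set" where
  "graph_aut E = {\<phi>. bij \<phi> \<and> (\<forall>i j. {\<phi> i, \<phi> j} \<in> E \<longleftrightarrow> {i, j} \<in> E)}"

definition framework :: "'n::finite set set \<Rightarrow> (real ^ 'k) ^ 'n \<Rightarrow> bool" where
  "framework E p \<longleftrightarrow> simple_graph E \<and> inj (\<lambda>i. p $ i)"

definition infinitesimal_motion ::
  "'n::finite set set \<Rightarrow> (real ^ 'k) ^ 'n \<Rightarrow> (real ^ 'k) ^ 'n \<Rightarrow> bool" where
  "infinitesimal_motion E p u \<longleftrightarrow>
     (\<forall>i j. {i, j} \<in> E \<longrightarrow> (p $ i - p $ j) \<bullet> (u $ i - u $ j) = 0)"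

definition skew_symmetric :: "real ^ 'k ^ 'k \<Rightarrow> bool" where
  "skew_symmetric A \<longleftrightarrow> transpose A = - A"

definition trivial_motion ::
  "'n::finite set set \<Rightarrow> (real ^ 'k) ^ 'n \<Rightarrow> (real ^ 'k) ^ 'n \<Rightarrow> bool" where
  "trivial_motion E p u \<longleftrightarrow> infinitesimal_motion E p u \<and>
     (\<exists>A t. skew_symmetric A \<and> (\<forall>i. u $ i = A *v (p $ i) + t))"

text \<open>
  A real function on the edge set is encoded as a vector indexed by all sets of vertices
  whose entries off the edge set are 0.
\<close>

definition self_stress ::
  "'n::finite set set \<Rightarrow> (real ^ 'k) ^ 'n \<Rightarrow> real ^ ('n set) \<Rightarrow> bool" where
  "self_stress E p \<omega> \<longleftrightarrow> (\<forall>e. e \<notin> E \<longrightarrow> \<omega> $ e = 0) \<and>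
     (\<forall>i. (\<Sum>j | {i, j} \<in> E. \<omega> $ {i, j} *\<^sub>R (p $ i - p $ j)) = 0)"

section \<open>Symmetric frameworks\<close>

text \<open>The set of frameworks \<open>(G,p)\<close> denoted R_(G,S), as a predicate.\<close>

definition symmetric_framework ::
  "(real ^ 'k \<Rightarrow> real ^ 'k) set \<Rightarrow> 'n::finite set set \<Rightarrow> (real ^ 'k) ^ 'n \<Rightarrow> bool" where
  "symmetric_framework S E p \<longleftrightarrow> framework E p \<and>
     (\<exists>\<Phi>. \<Phi> \<in> S \<rightarrow> graph_aut E \<and> (\<forall>x\<in>S. \<forall>i. x (p $ i) = p $ \<Phi> x i))"

text \<open>
  The vertex \<open>x(i) = \<Phi>(x)(i)\<close>. It is determined by the configuration, because the
  configuration of a framework is injective.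
\<close>

definition vertex_action ::
  "(real ^ 'k) ^ 'n::finite \<Rightarrow> (real ^ 'k \<Rightarrow> real ^ 'k) \<Rightarrow> 'n \<Rightarrow> 'n" where
  "vertex_action p x i = (THE j. x (p $ i) = p $ j)"

definition symmetric_motion ::
  "(real ^ 'k \<Rightarrow> real ^ 'k) set \<Rightarrow> (real ^ 'k) ^ 'n::finite \<Rightarrow> (real ^ 'k) ^ 'n \<Rightarrow> bool" where
  "symmetric_motion S p u \<longleftrightarrow> (\<forall>x\<in>S. \<forall>i. x (u $ i) = u $ vertex_action p x i)"

definition edge_orbit ::
  "(real ^ 'k \<Rightarrow> real ^ 'k) set \<Rightarrow> (real ^ 'k) ^ 'n::finite \<Rightarrow> 'n set \<Rightarrow> 'n set set" where
  "edge_orbit S p e = {vertex_action p x ` e | x. x \<in> S}"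

definition symmetric_stress ::
  "(real ^ 'k \<Rightarrow> real ^ 'k) set \<Rightarrow> 'n::finite set set \<Rightarrow> (real ^ 'k) ^ 'n
    \<Rightarrow> real ^ ('n set) \<Rightarrow> bool" where
  "symmetric_stress S E p \<omega> \<longleftrightarrow> (\<forall>e\<in>E. \<forall>f\<in>edge_orbit S p e. \<omega> $ f = \<omega> $ e)"

section \<open>Coning and frameworks on the sphere\<close>

definition star_matrix :: "real ^ 'd ^ 'd \<Rightarrow> real ^ 'd option ^ 'd option" where
  "star_matrix M = (\<chi> i j. case (i, j) of
       (Some a, Some b) \<Rightarrow> M $ a $ b
     | (None, None) \<Rightarrow> 1
     | _ \<Rightarrow> 0)"

definition star :: "(real ^ 'd \<Rightarrow> real ^ 'd) \<Rightarrow> real ^ 'd option \<Rightarrow> real ^ 'd option" where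
  "star x = (\<lambda>v. star_matrix (matrix x) *v v)"

definition homogenize :: "real ^ 'd \<Rightarrow> real ^ 'd option" where
  "homogenize a = (\<chi> k. case k of Some b \<Rightarrow> a $ b | None \<Rightarrow> 1)"

text \<open>\<open>projects_to q p\<close> is the condition \<open>\<pi>(q) = p\<close>; the scalars may have either sign.\<close>

definition projects_to :: "(real ^ 'd option) ^ 'n::finite \<Rightarrow> (real ^ 'd) ^ 'n \<Rightarrow> bool" where
  "projects_to q p \<longleftrightarrow> (\<forall>i. \<exists>\<alpha>. \<alpha> \<noteq> 0 \<and> q $ i = \<alpha> *\<^sub>R homogenize (p $ i))"

text \<open>The cone over a graph on \<open>'n\<close> has vertex type \<open>'n option\<close>, with \<open>None\<close> as cone vertex o.\<close>

definition cone_graph :: "'n set set \<Rightarrow> 'n option set set" where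
  "cone_graph E = (\<lambda>e. Some ` e) ` E \<union> {{None, Some i} | i. True}"

definition cone_config :: "(real ^ 'k) ^ 'n::finite \<Rightarrow> (real ^ 'k) ^ 'n option" where
  "cone_config q = (\<chi> i. case i of Some j \<Rightarrow> q $ j | None \<Rightarrow> 0)"

definition sphere_motion ::
  "'n::finite set set \<Rightarrow> (real ^ 'k) ^ 'n \<Rightarrow> (real ^ 'k) ^ 'n option \<Rightarrow> bool" where
  "sphere_motion E q u \<longleftrightarrow>
     infinitesimal_motion (cone_graph E) (cone_config q) u \<and> u $ None = 0"

definition trivial_sphere_motion ::
  "'n::finite set set \<Rightarrow> (real ^ 'k) ^ 'n \<Rightarrow> (real ^ 'k) ^ 'n option \<Rightarrow> bool" where
  "trivial_sphere_motion E q u \<longleftrightarrow> sphere_motion E q u \<and>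
     (\<exists>A. skew_symmetric A \<and> (\<forall>i. u $ i = A *v (cone_config q $ i)))"

section \<open>Isomorphic spaces\<close>

text \<open>
  The map \<open>f\<close> is linear on the ambient space; every linear map defined on a subspace has
  such an extension.
\<close>

definition isomorphic_subspaces :: "'a::real_vector set \<Rightarrow> 'b::real_vector set \<Rightarrow> bool" where
  "isomorphic_subspaces U W \<longleftrightarrow> subspace U \<and> subspace W \<and> (\<exists>f. linear f \<and> bij_betw f U W)"

end

theory Submission
  imports Defs
begin

text \<open>
  Write \<open>q i = \<alpha> i *\<^sub>R (p i, 1)\<close> with \<open>\<alpha> i \<noteq> 0\<close>. A velocity \<open>w i\<close> orthogonal to \<open>q i\<close> is determined
  by its first \<open>d\<close> coordinates, so it has the form \<open>\<alpha> i *\<^sub>R (u i, - (p i \<bullet> u i))\<close> for a unique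
  \<open>u i\<close>. With this normalisation
  \<open>(q i - q j) \<bullet> (w i - w j) = \<alpha> i * \<alpha> j * ((p i - p j) \<bullet> (u i - u j))\<close>,
  so \<open>u \<mapsto> w\<close> is a linear bijection between the infinitesimal motions of the two frameworks. It
  carries the trivial motion \<open>A p + t\<close> to \<open>B q\<close>, where \<open>B\<close> is the skew-symmetric matrix \<open>A\<close>
  bordered by the column \<open>t\<close> and the row \<open>- t\<close>, and every skew-symmetric matrix is of this form.

  For stresses, \<open>\<omega> {i, j}\<close> is divided by \<open>\<alpha> i * \<alpha> j\<close>, and the stress on the cone edge at \<open>i\<close>
  is chosen so that the last coordinate of the equilibrium condition at \<open>i\<close> holds. The remaining
  coordinates then give exactly equilibrium of \<open>\<omega>\<close> at \<open>i\<close>. Equilibrium at the cone vertex is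
  automatic, because the net forces of any stress sum to zero over all vertices.

  Both maps respect the symmetry because \<open>\<alpha>\<close> is constant on vertex orbits
  (\<open>scale_vertex_action\<close> below): \<open>x\<^sup>*\<close> maps \<open>q i\<close> to \<open>\<alpha> i *\<^sub>R (x (p i), 1)\<close>, and this has to be a
  point \<open>q j = \<alpha> j *\<^sub>R (p j, 1)\<close>. In particular the scalars have equal signs along an orbit, and
  the vertex action on the cone extends the action on the graph by fixing the cone vertex.
\<close>

section \<open>Vectors and skew-symmetric matrices with one additional coordinate\<close>

text \<open>The vector \<open>(a, b)\<close>.\<close>

definition append_coord :: "real ^ 'd \<Rightarrow> real \<Rightarrow> real ^ 'd option" where
  "append_coord a b = (\<chi> k. case k of Some j \<Rightarrow> a $ j | None \<Rightarrow> b)"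

lemma append_coord_nth [simp]: "append_coord a b $ Some j = a $ j" "append_coord a b $ None = b"
  by (simp_all add: append_coord_def)

lemma append_coord_eq_iff [simp]: "append_coord a b = append_coord c d \<longleftrightarrow> a = c \<and> b = d"
  by (auto simp: vec_eq_iff split_option_all)

lemma append_coord_cases: obtains a b where "v = append_coord a b"
proof
  show "v = append_coord (\<chi> j. v $ Some j) (v $ None)"
    by (simp add: vec_eq_iff split_option_all)
qed

lemma homogenize_eq_append_coord: "homogenize a = append_coord a 1"
  by (simp add: homogenize_def append_coord_def)

lemma append_coord_arith:
  "append_coord a b + append_coord c d = append_coord (a + c) (b + d)"
  "append_coord a b - append_coord c d = append_coord (a - c) (b - d)"
  "r *\<^sub>R append_coord a b = append_coord (r *\<^sub>R a) (r * b)"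
  "append_coord 0 0 = 0"
  by (simp_all add: vec_eq_iff split_option_all)

lemma sum_append_coord: "(\<Sum>i\<in>I. append_coord (f i) (g i)) = append_coord (\<Sum>i\<in>I. f i) (\<Sum>i\<in>I. g i)"
  by (simp add: vec_eq_iff split_option_all)

lemma sum_UNIV_option:
  fixes f :: "'a::finite option \<Rightarrow> 'b::comm_monoid_add"
  shows "(\<Sum>k\<in>UNIV. f k) = f None + (\<Sum>j\<in>UNIV. f (Some j))"
  by (simp add: UNIV_option_conv sum.reindex)

lemma inner_append_coord: "append_coord a b \<bullet> append_coord c d = a \<bullet> c + b * d"
  by (simp add: inner_vec_def sum_UNIV_option)

lemma star_append_coord:
  assumes "linear x"
  shows "star x (append_coord a b) = append_coord (x a) b"
proof -
  have "x a = matrix x *v a"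
    using assms by simp
  then show ?thesis
    unfolding star_def
    by (simp add: vec_eq_iff split_option_all star_matrix_def matrix_vector_mult_def
        sum_UNIV_option)
qed

text \<open>The matrix \<open>A\<close> with additional last column \<open>t\<close> and last row \<open>- t\<close>.\<close>

definition bordered :: "real ^ 'd ^ 'd \<Rightarrow> real ^ 'd \<Rightarrow> real ^ 'd option ^ 'd option" where
  "bordered A t = (\<chi> k. case k of Some i \<Rightarrow> append_coord (A $ i) (t $ i) | None \<Rightarrow> append_coord (- t) 0)"

lemma bordered_mult_append_coord:
  "bordered A t *v append_coord a b = append_coord (A *v a + b *\<^sub>R t) (- (t \<bullet> a))"
  by (simp add: vec_eq_iff split_option_all bordered_def matrix_vector_mult_def sum_UNIV_option
      inner_vec_def sum_negf)

lemma skew_symmetric_iff: "skew_symmetric A \<longleftrightarrow> (\<forall>i j. A $ j $ i = - A $ i $ j)"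
  by (simp add: skew_symmetric_def vec_eq_iff transpose_def)

lemma skew_symmetric_linear:
  fixes A B :: "real ^ 'k ^ 'k"
  shows "skew_symmetric (0 :: real ^ 'k ^ 'k)"
    and "skew_symmetric A \<Longrightarrow> skew_symmetric B \<Longrightarrow> skew_symmetric (A + B)"
    and "skew_symmetric A \<Longrightarrow> skew_symmetric (c *\<^sub>R A)"
proof -
  have transpose: "transpose (0 :: real ^ 'k ^ 'k) = 0"
    "transpose (A + B) = transpose A + transpose B"
    "transpose (c *\<^sub>R A) = c *\<^sub>R transpose A" for A B :: "real ^ 'k ^ 'k"
    by (simp_all add: vec_eq_iff transpose_def)
  show "skew_symmetric (0 :: real ^ 'k ^ 'k)"
    "skew_symmetric A \<Longrightarrow> skew_symmetric B \<Longrightarrow> skew_symmetric (A + B)"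
    "skew_symmetric A \<Longrightarrow> skew_symmetric (c *\<^sub>R A)"
    by (simp_all add: skew_symmetric_def transpose)
qed

lemma skew_symmetric_option_iff:
  "skew_symmetric B \<longleftrightarrow> (\<exists>A t. skew_symmetric A \<and> B = bordered A t)"
proof
  assume B: "skew_symmetric B"
  let ?A = "\<chi> i j. B $ Some i $ Some j" and ?t = "\<chi> i. B $ Some i $ None"
  have "B $ None $ None = 0"
    using B unfolding skew_symmetric_iff by (metis equal_neg_zero)
  moreover have "B $ None $ Some i = - B $ Some i $ None" for i
    using B unfolding skew_symmetric_iff by blast
  ultimately have "B = bordered ?A ?t"
    by (simp add: vec_eq_iff split_option_all bordered_def)
  moreover have "B $ Some j $ Some i = - B $ Some i $ Some j" for i j
    using B unfolding skew_symmetric_iff by blast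
  then have "skew_symmetric ?A"
    unfolding skew_symmetric_iff vec_lambda_beta by blast
  ultimately show "\<exists>A t. skew_symmetric A \<and> B = bordered A t"
    by blast
next
  assume "\<exists>A t. skew_symmetric A \<and> B = bordered A t"
  then obtain A t where A: "\<And>i j. A $ j $ i = - A $ i $ j" and B: "B = bordered A t"
    unfolding skew_symmetric_iff by blast
  show "skew_symmetric B"
    unfolding skew_symmetric_iff B split_option_all
    by (intro conjI allI) (simp_all add: bordered_def, rule A)
qed

lemma skew_symmetric_quadratic_form:
  assumes "skew_symmetric A"
  shows "v \<bullet> (A *v v) = 0"
proof -
  have "v \<bullet> (A *v v) = (transpose A *v v) \<bullet> v"
    by (simp add: dot_lmul_matrix)
  also have "\<dots> = ((- A) *v v) \<bullet> v"
    using assms by (simp add: skew_symmetric_def)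
  also have "\<dots> = - (v \<bullet> (A *v v))"
    by (simp add: inner_vec_def matrix_vector_mult_def sum_negf mult.commute)
  finally show ?thesis
    by simp
qed

section \<open>Cone graphs and spaces of motions and stresses\<close>

lemma isomorphic_subspaces_image:
  assumes "subspace U" "linear f" "inj f"
  shows "isomorphic_subspaces U (f ` U)"
  unfolding isomorphic_subspaces_def
  using assms by (meson inj_on_imp_bij_betw inj_on_subset linear_subspace_image subset_UNIV)

lemma Collect_eq_imageI:
  assumes "\<And>w. P w \<Longrightarrow> w \<in> range f" "\<And>u. P (f u) \<longleftrightarrow> Q u"
  shows "{w. P w} = f ` {u. Q u}"
  using assms by blast

lemma set_option_cases:
  fixes e :: "'a option set"
  obtains "None \<in> e" | e' where "e = Some ` e'"
proof (cases "None \<in> e")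
  case False
  then have "e = Some ` (Some -` e)"
    by (auto simp: image_iff) (metis not_None_eq)
  then show ?thesis
    using that by blast
qed (rule that)

lemma vimage_Some_simps:
  "Some -` {None, Some i} = {i}" "Some -` {Some i, None} = {i}"
  by auto

lemma cone_config_nth [simp]:
  "cone_config q $ Some i = q $ i" "cone_config q $ None = 0"
  by (simp_all add: cone_config_def)

lemma Some_image_in_cone_graph [simp]: "Some ` e \<in> cone_graph E \<longleftrightarrow> e \<in> E"
  by (auto simp: cone_graph_def inj_image_eq_iff)

lemma cone_graph_edges [simp]:
  "{Some i, Some j} \<in> cone_graph E \<longleftrightarrow> {i, j} \<in> E"
  "{None, Some i} \<in> cone_graph E"
  "{Some i, None} \<in> cone_graph E"
  using Some_image_in_cone_graph[of "{i, j}" E]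
  by (auto simp: cone_graph_def simp del: Some_image_in_cone_graph)

lemma cone_graph_cases:
  assumes "e \<in> cone_graph E"
  obtains e' where "e' \<in> E" "e = Some ` e'" | i where "e = {None, Some i}"
  using assms by (auto simp: cone_graph_def)

lemma neighbours_Some:
  "{v. {Some i, v} \<in> cone_graph E} = insert None (Some ` {j. {i, j} \<in> E})"
  by (auto simp: image_iff) (metis cone_graph_edges(1) not_None_eq)

lemma simple_graph_edge_neq:
  assumes "simple_graph E" "{i, j} \<in> E"
  shows "i \<noteq> j"
  using assms by (auto simp: simple_graph_def)

lemma sphere_motion_iff:
  "sphere_motion E q w \<longleftrightarrow> w $ None = 0 \<and> (\<forall>i. q $ i \<bullet> w $ Some i = 0) \<and>
    (\<forall>i j. {i, j} \<in> E \<longrightarrow> (q $ i - q $ j) \<bullet> (w $ Some i - w $ Some j) = 0)"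
  by (auto simp: sphere_motion_def infinitesimal_motion_def split_option_all)

lemma vertex_action_eqI:
  assumes "inj (\<lambda>i. p $ i)" "x (p $ i) = p $ j"
  shows "vertex_action p x i = j"
  unfolding vertex_action_def using assms by (auto dest: injD)

lemma subspace_infinitesimal_motions: "subspace {u. infinitesimal_motion E p u}"
proof -
  have "(a - b) \<bullet> (c + d - (e + f)) = (a - b) \<bullet> (c - e) + (a - b) \<bullet> (d - f)"
    for a b c d e f :: "real ^ 'a"
    by (simp add: algebra_simps)
  then show ?thesis
    unfolding subspace_def
    by (auto simp: infinitesimal_motion_def simp flip: scaleR_diff_right)
qed

lemma subspace_trivial_motions: "subspace {u. trivial_motion E p u}"
proof -
  have "subspace {u. \<exists>A t. skew_symmetric A \<and> (\<forall>i. u $ i = A *v (p $ i) + t)}" (is "subspace ?T")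
    unfolding subspace_def
  proof (intro conjI ballI allI)
    show "0 \<in> ?T"
      using skew_symmetric_linear(1) by (auto intro!: exI[of _ 0])
  next
    fix u v assume "u \<in> ?T" "v \<in> ?T"
    then obtain A t B s where "skew_symmetric A" "\<forall>i. u $ i = A *v (p $ i) + t"
      "skew_symmetric B" "\<forall>i. v $ i = B *v (p $ i) + s" by auto
    then show "u + v \<in> ?T"
      using skew_symmetric_linear(2)
      by (auto intro!: exI[of _ "A + B"] exI[of _ "t + s"]
          simp: matrix_vector_mult_add_rdistrib)
  next
    fix c :: real and u assume "u \<in> ?T"
    then obtain A t where "skew_symmetric A" "\<forall>i. u $ i = A *v (p $ i) + t" by auto
    then show "c *\<^sub>R u \<in> ?T"
      using skew_symmetric_linear(3)
      by (auto intro!: exI[of _ "c *\<^sub>R A"] exI[of _ "c *\<^sub>R t"]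
          simp: scaleR_matrix_vector_assoc scaleR_add_right)
  qed
  from subspace_inter[OF subspace_infinitesimal_motions[of E p] this] show ?thesis
    by (simp add: trivial_motion_def Int_def)
qed

lemma subspace_symmetric_motions:
  assumes "\<And>x. x \<in> S \<Longrightarrow> linear x"
  shows "subspace {u. symmetric_motion S p u}"
  unfolding subspace_def
  using assms by (auto simp: symmetric_motion_def linear_0 linear_add linear_scale)

lemma subspace_symmetric_stresses:
  fixes p :: "(real ^ 'k) ^ 'n::finite"
  shows "subspace {\<omega>. self_stress E p \<omega> \<and> symmetric_stress S E p \<omega>}"
proof -
  have "(\<Sum>j\<in>J. (c * f j) *\<^sub>R v j) = 0" if "(\<Sum>j\<in>J. f j *\<^sub>R v j) = 0"
    for J c and f :: "'n \<Rightarrow> real" and v :: "'n \<Rightarrow> real ^ 'k"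
    using arg_cong[OF that, of "\<lambda>s. c *\<^sub>R s"] by (simp add: scaleR_sum_right)
  then show ?thesis
    unfolding subspace_def
    by (auto simp: self_stress_def symmetric_stress_def scaleR_add_left sum.distrib)
qed

text \<open>Contributions of \<open>{i, j}\<close> at its two ends cancel, so all net forces sum to zero.\<close>

lemma sum_net_forces_eq_0:
  fixes p :: "(real ^ 'k) ^ 'n::finite"
  shows "(\<Sum>i\<in>UNIV. \<Sum>j | {i, j} \<in> E. \<omega> $ {i, j} *\<^sub>R (p $ i - p $ j)) = 0" (is "?s = 0")
proof -
  have "?s = (\<Sum>i\<in>UNIV. \<Sum>j\<in>UNIV. if {i, j} \<in> E then \<omega> $ {i, j} *\<^sub>R (p $ i - p $ j) else 0)"
    by (simp add: sum.If_cases)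
  also have "\<dots> = (\<Sum>j\<in>UNIV. \<Sum>i\<in>UNIV. if {i, j} \<in> E then \<omega> $ {i, j} *\<^sub>R (p $ i - p $ j) else 0)"
    by (rule sum.swap)
  also have "\<dots> = (\<Sum>j\<in>UNIV. \<Sum>i\<in>UNIV.
      - (if {j, i} \<in> E then \<omega> $ {j, i} *\<^sub>R (p $ j - p $ i) else 0))"
    by (intro sum.cong refl) (auto simp: insert_commute scaleR_diff_right)
  also have "\<dots> = - ?s"
    by (simp add: sum_negf sum.If_cases)
  finally have "2 *\<^sub>R ?s = 0"
    by (simp add: scaleR_2)
  then show ?thesis
    by simp
qed

section \<open>Transfer of motions\<close>

text \<open>
  A framework with joints \<open>p i\<close> together with arbitrary nonzero multiples \<open>q i\<close> of \<open>(p i, 1)\<close>,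
  with the scalars \<open>\<alpha> i\<close> fixed.
\<close>

locale projected_framework =
  fixes E :: "'n::finite set set"
    and p :: "(real ^ 'd) ^ 'n"
    and q :: "(real ^ 'd option) ^ 'n"
    and \<alpha> :: "'n \<Rightarrow> real"
  assumes simple: "simple_graph E"
    and scale_nz [simp]: "\<alpha> i \<noteq> 0"
    and q_eq: "q $ i = \<alpha> i *\<^sub>R homogenize (p $ i)"
begin

lemma q_eq_append_coord: "q $ i = append_coord (\<alpha> i *\<^sub>R p $ i) (\<alpha> i)"
  by (simp add: q_eq homogenize_eq_append_coord append_coord_arith)

text \<open>
  The velocities \<open>\<alpha> i *\<^sub>R (u i, - (p i \<bullet> u i))\<close> at the joints, which are orthogonal to the points
  \<open>q i\<close>, and velocity 0 at the cone vertex. The factor \<open>\<alpha> i\<close> makes the edge conditions of the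
  two frameworks proportional.
\<close>

definition lift_motion :: "(real ^ 'd) ^ 'n \<Rightarrow> (real ^ 'd option) ^ 'n option" where
  "lift_motion u = (\<chi> v. case v of
       None \<Rightarrow> 0
     | Some i \<Rightarrow> \<alpha> i *\<^sub>R append_coord (u $ i) (- (p $ i \<bullet> u $ i)))"

lemma lift_motion_nth [simp]:
  "lift_motion u $ None = 0"
  "lift_motion u $ Some i = append_coord (\<alpha> i *\<^sub>R u $ i) (- \<alpha> i * (p $ i \<bullet> u $ i))"
  by (simp_all add: lift_motion_def append_coord_arith)

lemma linear_lift_motion: "linear lift_motion"
  by (rule linearI)
    (simp_all add: vec_eq_iff split_option_all inner_add_right algebra_simps)

lemma inj_lift_motion: "inj lift_motion"
proof (rule injI)
  fix u v assume "lift_motion u = lift_motion v"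
  then have "lift_motion u $ Some i = lift_motion v $ Some i" for i
    by simp
  then have "u $ i = v $ i" for i
    by simp
  then show "u = v"
    by (simp add: vec_eq_iff)
qed

lemma sphere_motion_lift_iff: "sphere_motion E q (lift_motion u) \<longleftrightarrow> infinitesimal_motion E p u"
proof -
  have "(q $ i - q $ j) \<bullet> (lift_motion u $ Some i - lift_motion u $ Some j)
      = \<alpha> i * \<alpha> j * ((p $ i - p $ j) \<bullet> (u $ i - u $ j))" for i j
    by (simp add: q_eq_append_coord append_coord_arith inner_append_coord
        inner_diff_left inner_diff_right algebra_simps)
  moreover have "q $ i \<bullet> lift_motion u $ Some i = 0" for i
    by (simp add: q_eq_append_coord inner_append_coord algebra_simps)
  ultimately show ?thesis
    by (simp add: sphere_motion_iff infinitesimal_motion_def)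
qed

lemma sphere_motion_is_lift:
  assumes "sphere_motion E q w"
  obtains u where "w = lift_motion u"
proof -
  have "\<exists>a. w $ Some i = append_coord (\<alpha> i *\<^sub>R a) (- \<alpha> i * (p $ i \<bullet> a))" for i
  proof -
    obtain a b where ab: "w $ Some i = append_coord a b"
      by (rule append_coord_cases)
    have "q $ i \<bullet> w $ Some i = 0"
      using assms by (simp add: sphere_motion_iff)
    then have "\<alpha> i * (p $ i \<bullet> a + b) = 0"
      by (simp add: q_eq_append_coord ab inner_append_coord algebra_simps)
    then have "b = - (p $ i \<bullet> a)"
      by simp
    then show ?thesis
      using ab by (intro exI[of _ "(1 / \<alpha> i) *\<^sub>R a"]) simp
  qed
  then obtain f where f: "\<And>i. w $ Some i = append_coord (\<alpha> i *\<^sub>R f i) (- \<alpha> i * (p $ i \<bullet> f i))"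
    by metis
  moreover have "w $ None = 0"
    using assms by (simp add: sphere_motion_def)
  ultimately have "w = lift_motion (\<chi> i. f i)"
    by (subst vec_eq_iff) (simp add: split_option_all)
  then show ?thesis ..
qed

text \<open>
  The last coordinate agrees because \<open>p i \<bullet> (A p i) = 0\<close> for skew-symmetric \<open>A\<close>.
\<close>

lemma lift_motion_eq_bordered_iff:
  assumes "skew_symmetric A"
  shows "(\<forall>v. lift_motion u $ v = bordered A t *v (cone_config q $ v))
    \<longleftrightarrow> (\<forall>i. u $ i = A *v (p $ i) + t)"
proof -
  have "bordered A t *v q $ i
      = append_coord (\<alpha> i *\<^sub>R (A *v p $ i + t)) (- \<alpha> i * (p $ i \<bullet> (A *v p $ i + t)))" for i
    using skew_symmetric_quadratic_form[OF assms]
    by (simp add: q_eq_append_coord bordered_mult_append_coord matrix_vector_mult_scaleR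
        scaleR_add_right inner_add_right inner_commute)
  then show ?thesis
    by (auto simp: split_option_all)
qed

lemma trivial_sphere_motion_lift_iff:
  "trivial_sphere_motion E q (lift_motion u) \<longleftrightarrow> trivial_motion E p u"
  unfolding trivial_sphere_motion_def trivial_motion_def sphere_motion_lift_iff
    skew_symmetric_option_iff
  using lift_motion_eq_bordered_iff by blast

section \<open>Transfer of self-stresses\<close>

text \<open>
  The stress on \<open>{o, i}\<close> that balances the last coordinate at the vertex \<open>i\<close>.
\<close>

definition cone_edge_stress :: "real ^ ('n set) \<Rightarrow> 'n \<Rightarrow> real" where
  "cone_edge_stress \<omega> i = (\<Sum>j | {i, j} \<in> E. \<omega> $ {i, j} * (1 / (\<alpha> i)\<^sup>2 - 1 / (\<alpha> i * \<alpha> j)))"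

text \<open>
  The stress \<open>\<omega> {i, j} / (\<alpha> i * \<alpha> j)\<close> on the edges of the base, and \<open>cone_edge_stress\<close> on the
  edges at the cone vertex. A set \<open>e\<close> of vertices of the cone is inspected through its trace \<open>Some -` e\<close> on the base;
  the entries at sets that are not edges of the cone must be 0.
\<close>

definition lift_stress :: "real ^ ('n set) \<Rightarrow> real ^ ('n option set)" where
  "lift_stress \<omega> = (\<chi> e.
     if None \<notin> e then \<omega> $ (Some -` e) / (\<Prod>i\<in>Some -` e. \<alpha> i)
     else if card (Some -` e) = 1 then \<Sum>i\<in>Some -` e. cone_edge_stress \<omega> i
     else 0)"

lemma lift_stress_base: "lift_stress \<omega> $ (Some ` e) = \<omega> $ e / (\<Prod>i\<in>e. \<alpha> i)"
  by (simp add: lift_stress_def inj_vimage_image_eq)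

lemma lift_stress_cone_edge:
  "lift_stress \<omega> $ {None, Some i} = cone_edge_stress \<omega> i"
  "lift_stress \<omega> $ {Some i, None} = cone_edge_stress \<omega> i"
  by (simp_all add: lift_stress_def vimage_Some_simps)

lemma lift_stress_off_cone:
  assumes "None \<in> e" "e \<notin> cone_graph E"
  shows "lift_stress \<omega> $ e = 0"
proof -
  have "card (Some -` e) \<noteq> 1"
  proof
    assume "card (Some -` e) = 1"
    then obtain i where i: "Some -` e = {i}"
      by (auto simp: card_1_singleton_iff)
    have "e = {None, Some i}"
    proof (rule Set.set_eqI)
      fix v show "v \<in> e \<longleftrightarrow> v \<in> {None, Some i}"
        using assms(1) i by (cases v) auto
    qed
    then show False
      using assms(2) by simp
  qed
  then show ?thesis
    using assms(1) by (simp add: lift_stress_def)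
qed

lemma linear_lift_stress: "linear lift_stress"
proof (rule linearI)
  show "lift_stress (\<omega> + \<omega>') = lift_stress \<omega> + lift_stress \<omega>'" for \<omega> \<omega>'
    by (simp add: vec_eq_iff lift_stress_def cone_edge_stress_def add_divide_distrib
        distrib_right sum.distrib)
  show "lift_stress (c *\<^sub>R \<omega>) = c *\<^sub>R lift_stress \<omega>" for c \<omega>
    by (simp add: vec_eq_iff lift_stress_def cone_edge_stress_def sum_distrib_left mult.assoc)
qed

lemma inj_lift_stress: "inj lift_stress"
proof (rule injI)
  fix \<omega> \<omega>' assume "lift_stress \<omega> = lift_stress \<omega>'"
  then have "lift_stress \<omega> $ (Some ` e) = lift_stress \<omega>' $ (Some ` e)" for e
    by simp
  then show "\<omega> = \<omega>'"
    by (simp add: vec_eq_iff lift_stress_base)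
qed

lemma cone_net_force_Some:
  "(\<Sum>v | {Some i, v} \<in> cone_graph E. \<omega> $ {Some i, v} *\<^sub>R (cone_config q $ Some i - cone_config q $ v))
    = \<omega> $ {None, Some i} *\<^sub>R q $ i
      + (\<Sum>j | {i, j} \<in> E. \<omega> $ (Some ` {i, j}) *\<^sub>R (q $ i - q $ j))"
  unfolding neighbours_Some
  by (subst sum.insert) (auto simp: sum.reindex insert_commute)

text \<open>
  The net force at \<open>i\<close> of a lifted stress is that of the original stress, up to the factor
  \<open>1 / \<alpha> i\<close>.
\<close>

lemma cone_net_force_lift:
  "(\<Sum>v | {Some i, v} \<in> cone_graph E.
      lift_stress \<omega> $ {Some i, v} *\<^sub>R (cone_config q $ Some i - cone_config q $ v))
    = append_coord ((1 / \<alpha> i) *\<^sub>R (\<Sum>j | {i, j} \<in> E. \<omega> $ {i, j} *\<^sub>R (p $ i - p $ j))) 0"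
proof -
  have edge: "(\<omega> $ {i, j} * (1 / (\<alpha> i)\<^sup>2 - 1 / (\<alpha> i * \<alpha> j))) *\<^sub>R q $ i
      + lift_stress \<omega> $ (Some ` {i, j}) *\<^sub>R (q $ i - q $ j)
      = append_coord ((1 / \<alpha> i) *\<^sub>R \<omega> $ {i, j} *\<^sub>R (p $ i - p $ j)) 0" if "{i, j} \<in> E" for j
  proof -
    have ij: "i \<noteq> j"
      using simple_graph_edge_neq[OF simple that] .
    show ?thesis
      unfolding lift_stress_base q_eq_append_coord append_coord_arith append_coord_eq_iff
      using ij by (simp add: vec_eq_iff field_simps power2_eq_square)
  qed
  show ?thesis
    unfolding cone_net_force_Some lift_stress_cone_edge cone_edge_stress_def scaleR_sum_left
      sum.distrib[symmetric]
    using edge by (simp add: sum_append_coord scaleR_sum_right)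
qed

lemma self_stress_lift_iff:
  "self_stress (cone_graph E) (cone_config q) (lift_stress \<omega>) \<longleftrightarrow> self_stress E p \<omega>"
proof -
  have "(\<forall>e. e \<notin> cone_graph E \<longrightarrow> lift_stress \<omega> $ e = 0) \<longleftrightarrow> (\<forall>e. e \<notin> E \<longrightarrow> \<omega> $ e = 0)"
  proof (intro iffI allI impI)
    fix e assume "\<forall>e. e \<notin> cone_graph E \<longrightarrow> lift_stress \<omega> $ e = 0" "e \<notin> E"
    then have "lift_stress \<omega> $ (Some ` e) = 0"
      by simp
    then show "\<omega> $ e = 0"
      by (simp add: lift_stress_base)
  next
    fix e assume off: "\<forall>e. e \<notin> E \<longrightarrow> \<omega> $ e = 0" and e: "e \<notin> cone_graph E"
    show "lift_stress \<omega> $ e = 0"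
      by (cases e rule: set_option_cases)
        (use off e lift_stress_off_cone in \<open>auto simp: lift_stress_base\<close>)
  qed
  moreover have "(\<forall>v. (\<Sum>w | {v, w} \<in> cone_graph E.
        lift_stress \<omega> $ {v, w} *\<^sub>R (cone_config q $ v - cone_config q $ w)) = 0)
      \<longleftrightarrow> (\<forall>i. (\<Sum>j | {i, j} \<in> E. \<omega> $ {i, j} *\<^sub>R (p $ i - p $ j)) = 0)"
    (is "(\<forall>v. ?net v = 0) \<longleftrightarrow> ?eq")
  proof -
    \<comment> \<open>Equilibrium at the cone vertex follows from equilibrium at all other vertices.\<close>
    have "?net None + (\<Sum>i\<in>UNIV. ?net (Some i)) = 0"
      using sum_net_forces_eq_0[where E = "cone_graph E" and p = "cone_config q"
          and \<omega> = "lift_stress \<omega>"]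
      unfolding sum_UNIV_option .
    then have "(\<forall>v. ?net v = 0) \<longleftrightarrow> (\<forall>i. ?net (Some i) = 0)"
      by (auto simp: split_option_all)
    also have "\<dots> \<longleftrightarrow> ?eq"
      unfolding cone_net_force_lift by (simp flip: append_coord_arith(4))
    finally show ?thesis .
  qed
  ultimately show ?thesis
    unfolding self_stress_def by blast
qed

lemma cone_self_stress_is_lift:
  assumes "self_stress (cone_graph E) (cone_config q) \<sigma>"
  obtains \<omega> where "\<sigma> = lift_stress \<omega>"
proof -
  define \<omega> where "\<omega> = (\<chi> e. \<sigma> $ (Some ` e) * (\<Prod>i\<in>e. \<alpha> i))"
  have base: "\<sigma> $ (Some ` e) = lift_stress \<omega> $ (Some ` e)" for e
    by (simp add: lift_stress_base \<omega>_def)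
  \<comment> \<open>The last coordinate of the equilibrium condition at \<open>i\<close> determines the stress on \<open>{o, i}\<close>.\<close>
  have cone: "\<sigma> $ {None, Some i} = lift_stress \<omega> $ {None, Some i}" for i
  proof -
    have net: "\<tau> $ {None, Some i} * \<alpha> i
          + (\<Sum>j | {i, j} \<in> E. \<tau> $ (Some ` {i, j}) * (\<alpha> i - \<alpha> j)) = 0"
      if "(\<Sum>v | {Some i, v} \<in> cone_graph E.
        \<tau> $ {Some i, v} *\<^sub>R (cone_config q $ Some i - cone_config q $ v)) $ None = 0" for \<tau>
      using that unfolding cone_net_force_Some
      by (simp add: q_eq_append_coord sum_component)
    have "\<sigma> $ {None, Some i} * \<alpha> i
          + (\<Sum>j | {i, j} \<in> E. \<sigma> $ (Some ` {i, j}) * (\<alpha> i - \<alpha> j)) = 0"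
    proof (intro net)
      show "(\<Sum>v | {Some i, v} \<in> cone_graph E. \<sigma> $ {Some i, v} *\<^sub>R
          (cone_config q $ Some i - cone_config q $ v)) $ None = 0"
        using assms[unfolded self_stress_def, THEN conjunct2, rule_format, of "Some i"]
        by (simp only: zero_index)
    qed
    moreover have "lift_stress \<omega> $ {None, Some i} * \<alpha> i
          + (\<Sum>j | {i, j} \<in> E. lift_stress \<omega> $ (Some ` {i, j}) * (\<alpha> i - \<alpha> j)) = 0"
      by (intro net) (simp only: cone_net_force_lift append_coord_nth)
    ultimately have "\<sigma> $ {None, Some i} * \<alpha> i = lift_stress \<omega> $ {None, Some i} * \<alpha> i"
      unfolding base by linarith
    then show ?thesis
      by simp
  qed
  have "\<sigma> = lift_stress \<omega>"
  proof (subst vec_eq_iff, intro allI)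
    fix e show "\<sigma> $ e = lift_stress \<omega> $ e"
    proof (cases e rule: set_option_cases)
      case 1
      show ?thesis
      proof (cases "e \<in> cone_graph E")
        case True
        then show ?thesis
          using 1 cone by (auto elim: cone_graph_cases)
      next
        case False
        then show ?thesis
          using 1 assms lift_stress_off_cone by (simp add: self_stress_def)
      qed
    next
      case 2
      then show ?thesis
        using base by simp
    qed
  qed
  then show ?thesis ..
qed

end

section \<open>Compatibility with the symmetry\<close>

text \<open>
  Both the framework and the cone over the \<open>q i\<close> are symmetric; the second condition is what
  forces the scalars to be constant on vertex orbits.
\<close>

locale symmetric_projected_framework = projected_framework E p q \<alpha>
  for E :: "'n::finite set set"
    and p :: "(real ^ 'd) ^ 'n"
    and q :: "(real ^ 'd option) ^ 'n"
    and \<alpha> :: "'n \<Rightarrow> real" +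
  fixes S :: "(real ^ 'd \<Rightarrow> real ^ 'd) set"
  assumes group: "symmetry_group S"
    and sym_p: "symmetric_framework S E p"
    and sym_q: "symmetric_framework (star ` S) (cone_graph E) (cone_config q)"
begin

lemma orthogonal_symmetry: "x \<in> S \<Longrightarrow> orthogonal_transformation x"
  using group subgroup.subset[of S orthogonal_group]
  by (auto simp: symmetry_group_def orthogonal_group_def)

lemma linear_symmetry: "x \<in> S \<Longrightarrow> linear x"
  by (rule orthogonal_transformation_linear[OF orthogonal_symmetry])

lemma inj_p: "inj (\<lambda>i. p $ i)" and inj_q: "inj (\<lambda>v. cone_config q $ v)"
  using sym_p sym_q by (auto simp: symmetric_framework_def framework_def)

lemma vertex_action_p:
  assumes "x \<in> S"
  shows "x (p $ i) = p $ vertex_action p x i" "vertex_action p x \<in> graph_aut E"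
proof -
  obtain \<Phi> where \<Phi>: "\<Phi> \<in> S \<rightarrow> graph_aut E" "\<forall>x\<in>S. \<forall>i. x (p $ i) = p $ \<Phi> x i"
    using sym_p by (auto simp: symmetric_framework_def)
  then have "vertex_action p x = \<Phi> x"
    using assms by (intro ext vertex_action_eqI[OF inj_p]) auto
  then show "x (p $ i) = p $ vertex_action p x i" "vertex_action p x \<in> graph_aut E"
    using \<Phi> assms by auto
qed

lemma star_q: "x \<in> S \<Longrightarrow> star x (q $ i) = append_coord (\<alpha> i *\<^sub>R p $ vertex_action p x i) (\<alpha> i)"
  by (simp add: q_eq_append_coord star_append_coord linear_symmetry linear_scale vertex_action_p)

text \<open>The last coordinate of \<open>x\<^sup>* (q i)\<close> is \<open>\<alpha> i\<close>, and \<open>x\<^sup>*\<close> maps \<open>q i\<close> to some \<open>q j\<close>.\<close>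

lemma scale_vertex_action:
  assumes "x \<in> S"
  shows "\<alpha> (vertex_action p x i) = \<alpha> i"
proof -
  obtain v where v: "star x (q $ i) = cone_config q $ v"
    using sym_q assms unfolding symmetric_framework_def by (metis cone_config_nth(1) imageI)
  show ?thesis
  proof (cases v)
    case None
    then show ?thesis
      using v by (simp add: star_q assms flip: append_coord_arith(4))
  next
    case (Some j)
    then have "append_coord (\<alpha> i *\<^sub>R p $ vertex_action p x i) (\<alpha> i)
        = append_coord (\<alpha> j *\<^sub>R p $ j) (\<alpha> j)"
      using v star_q[OF assms, of i] q_eq_append_coord[of j] by (metis cone_config_nth(1))
    then have "\<alpha> i = \<alpha> j" "\<alpha> i *\<^sub>R p $ vertex_action p x i = \<alpha> j *\<^sub>R p $ j"
      unfolding append_coord_eq_iff by blast+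
    then have "p $ vertex_action p x i = p $ j"
      by simp
    then have "vertex_action p x i = j"
      using injD[OF inj_p] by blast
    then show ?thesis
      using \<open>\<alpha> i = \<alpha> j\<close> by simp
  qed
qed

lemma vertex_action_cone:
  assumes "x \<in> S"
  shows "vertex_action (cone_config q) (star x) (Some i) = Some (vertex_action p x i)"
    and "vertex_action (cone_config q) (star x) None = None"
proof -
  show "vertex_action (cone_config q) (star x) (Some i) = Some (vertex_action p x i)"
    by (rule vertex_action_eqI[OF inj_q])
      (simp only: cone_config_nth star_q[OF assms]
        q_eq_append_coord[of "vertex_action p x i"] scale_vertex_action[OF assms])
  show "vertex_action (cone_config q) (star x) None = None"
    by (rule vertex_action_eqI[OF inj_q]) (simp add: star_def)
qed

lemma symmetric_motion_lift_iff:
  "symmetric_motion (star ` S) (cone_config q) (lift_motion u) \<longleftrightarrow> symmetric_motion S p u"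
proof -
  have "star x (lift_motion u $ Some i) = lift_motion u $ Some (vertex_action p x i)
      \<longleftrightarrow> x (u $ i) = u $ vertex_action p x i" if x: "x \<in> S" for x i
  proof -
    \<comment> \<open>Orthogonality of \<open>x\<close> makes the last coordinates agree.\<close>
    have "p $ vertex_action p x i \<bullet> x (u $ i) = p $ i \<bullet> u $ i"
      using orthogonal_symmetry[OF x] vertex_action_p(1)[OF x, of i]
      by (metis orthogonal_transformation_def)
    then show ?thesis
      using x by (auto simp: star_append_coord linear_symmetry linear_scale scale_vertex_action)
  qed
  moreover have "star x 0 = 0" for x :: "real ^ 'd \<Rightarrow> real ^ 'd"
    by (simp add: star_def)
  ultimately show ?thesis
    by (auto simp: symmetric_motion_def split_option_all vertex_action_cone)
qed

lemma cone_edge_stress_vertex_action: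
  assumes sym: "symmetric_stress S E p \<omega>" and x: "x \<in> S"
  shows "cone_edge_stress \<omega> (vertex_action p x i) = cone_edge_stress \<omega> i"
proof -
  let ?x = "vertex_action p x"
  have bij: "bij ?x" and edge: "\<And>i j. {?x i, ?x j} \<in> E \<longleftrightarrow> {i, j} \<in> E"
    using vertex_action_p(2)[OF x] by (auto simp: graph_aut_def)
  have "bij_betw ?x {j. {i, j} \<in> E} {j. {?x i, j} \<in> E}"
    using bij edge by (intro bij_betw_imageI)
      (auto simp: bij_def inj_on_def image_iff, metis surjD)
  then have "cone_edge_stress \<omega> (?x i)
      = (\<Sum>j | {i, j} \<in> E. \<omega> $ {?x i, ?x j} * (1 / (\<alpha> (?x i))\<^sup>2 - 1 / (\<alpha> (?x i) * \<alpha> (?x j))))"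
    unfolding cone_edge_stress_def by (rule sum.reindex_bij_betw[symmetric])
  also have "\<dots> = cone_edge_stress \<omega> i"
    unfolding cone_edge_stress_def
  proof (intro sum.cong refl)
    fix j assume "j \<in> {j. {i, j} \<in> E}"
    moreover have "{?x i, ?x j} \<in> edge_orbit S p {i, j}"
      using x by (auto simp: edge_orbit_def)
    ultimately have "\<omega> $ {?x i, ?x j} = \<omega> $ {i, j}"
      using sym by (auto simp: symmetric_stress_def)
    then show "\<omega> $ {?x i, ?x j} * (1 / (\<alpha> (?x i))\<^sup>2 - 1 / (\<alpha> (?x i) * \<alpha> (?x j)))
        = \<omega> $ {i, j} * (1 / (\<alpha> i)\<^sup>2 - 1 / (\<alpha> i * \<alpha> j))"
      by (simp add: scale_vertex_action x)
  qed
  finally show ?thesis .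
qed

lemma symmetric_stress_lift_iff:
  "symmetric_stress (star ` S) (cone_graph E) (cone_config q) (lift_stress \<omega>)
    \<longleftrightarrow> symmetric_stress S E p \<omega>"
proof -
  have base: "lift_stress \<omega> $ (vertex_action (cone_config q) (star x) ` Some ` e)
      = \<omega> $ (vertex_action p x ` e) / (\<Prod>i\<in>e. \<alpha> i)" if x: "x \<in> S" for x e
  proof -
    have "inj (vertex_action p x)"
      using vertex_action_p(2)[OF x] by (auto simp: graph_aut_def bij_def)
    then have "(\<Prod>i\<in>vertex_action p x ` e. \<alpha> i) = (\<Prod>i\<in>e. \<alpha> i)"
      using x by (subst prod.reindex) (auto simp: scale_vertex_action inj_on_def)
    moreover have "vertex_action (cone_config q) (star x) ` Some ` e = Some ` vertex_action p x ` e"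
      using x by (simp add: image_image vertex_action_cone)
    ultimately show ?thesis
      by (simp only: lift_stress_base)
  qed
  show ?thesis
  proof
    assume lift: "symmetric_stress (star ` S) (cone_graph E) (cone_config q) (lift_stress \<omega>)"
    show "symmetric_stress S E p \<omega>"
      unfolding symmetric_stress_def
    proof (intro ballI)
      fix e f assume e: "e \<in> E" and "f \<in> edge_orbit S p e"
      then obtain x where x: "x \<in> S" and f: "f = vertex_action p x ` e"
        by (auto simp: edge_orbit_def)
      have "lift_stress \<omega> $ (vertex_action (cone_config q) (star x) ` Some ` e)
          = lift_stress \<omega> $ (Some ` e)"
        using lift e x unfolding symmetric_stress_def edge_orbit_def
        by (metis (mono_tags, lifting) Some_image_in_cone_graph imageI mem_Collect_eq)
      then show "\<omega> $ f = \<omega> $ e"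
        using base[OF x] f by (simp add: lift_stress_base)
    qed
  next
    assume sym: "symmetric_stress S E p \<omega>"
    show "symmetric_stress (star ` S) (cone_graph E) (cone_config q) (lift_stress \<omega>)"
      unfolding symmetric_stress_def
    proof (intro ballI)
      fix e f assume e: "e \<in> cone_graph E" and "f \<in> edge_orbit (star ` S) (cone_config q) e"
      then obtain x where x: "x \<in> S" and f: "f = vertex_action (cone_config q) (star x) ` e"
        by (auto simp: edge_orbit_def)
      from e show "lift_stress \<omega> $ f = lift_stress \<omega> $ e"
      proof (cases rule: cone_graph_cases)
        case (1 e')
        have "\<omega> $ (vertex_action p x ` e') = \<omega> $ e'"
          using sym 1(1) x by (auto simp: symmetric_stress_def edge_orbit_def)
        then show ?thesis
          using 1(2) f base[OF x] by (simp add: lift_stress_base)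
      next
        case (2 i)
        then have "f = {None, Some (vertex_action p x i)}"
          using f x by (simp add: vertex_action_cone)
        then show ?thesis
          using 2 sym x by (simp add: lift_stress_cone_edge cone_edge_stress_vertex_action)
      qed
    qed
  qed
qed

lemma lift_symmetric_motions:
  "{w. sphere_motion E q w \<and> symmetric_motion (star ` S) (cone_config q) w}
    = lift_motion ` {u. infinitesimal_motion E p u \<and> symmetric_motion S p u}"
  by (rule Collect_eq_imageI)
    (blast elim: sphere_motion_is_lift, simp add: sphere_motion_lift_iff symmetric_motion_lift_iff)

lemma lift_symmetric_trivial_motions:
  "{w. trivial_sphere_motion E q w \<and> symmetric_motion (star ` S) (cone_config q) w}
    = lift_motion ` {u. trivial_motion E p u \<and> symmetric_motion S p u}"
proof (rule Collect_eq_imageI)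
  fix w
  assume "trivial_sphere_motion E q w \<and> symmetric_motion (star ` S) (cone_config q) w"
  then have "sphere_motion E q w"
    by (simp add: trivial_sphere_motion_def)
  then show "w \<in> range lift_motion"
    by (blast elim: sphere_motion_is_lift)
qed (simp add: trivial_sphere_motion_lift_iff symmetric_motion_lift_iff)

lemma lift_symmetric_stresses:
  "{\<sigma>. self_stress (cone_graph E) (cone_config q) \<sigma>
      \<and> symmetric_stress (star ` S) (cone_graph E) (cone_config q) \<sigma>}
    = lift_stress ` {\<omega>. self_stress E p \<omega> \<and> symmetric_stress S E p \<omega>}"
  by (rule Collect_eq_imageI)
    (blast elim: cone_self_stress_is_lift, simp add: self_stress_lift_iff symmetric_stress_lift_iff)

lemma nontrivial_symmetric_motion_iff:
  "(\<exists>u. infinitesimal_motion E p u \<and> \<not> trivial_motion E p u \<and> symmetric_motion S p u)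
    \<longleftrightarrow> (\<exists>w. sphere_motion E q w \<and> \<not> trivial_sphere_motion E q w
          \<and> symmetric_motion (star ` S) (cone_config q) w)"
  (is "(\<exists>u. ?P u) \<longleftrightarrow> (\<exists>w. ?Q w)")
proof -
  have "?Q (lift_motion u) \<longleftrightarrow> ?P u" for u
    by (simp add: sphere_motion_lift_iff trivial_sphere_motion_lift_iff symmetric_motion_lift_iff)
  moreover have "w \<in> range lift_motion" if "?Q w" for w
    using that by (blast elim: sphere_motion_is_lift)
  ultimately show ?thesis
    by blast
qed

end

section \<open>Isomorphism of the symmetric spaces\<close>

theorem corollary6p2:
  fixes S :: "(real ^ 'd \<Rightarrow> real ^ 'd) set"
    and E :: "'n::finite set set"
    and p :: "(real ^ 'd) ^ 'n"
    and q :: "(real ^ 'd option) ^ 'n"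
  assumes "symmetry_group S"
    and "symmetric_framework S E p"
    and "\<forall>i. q $ i \<in> sphere 0 1"
    and "symmetric_framework (star ` S) (cone_graph E) (cone_config q)"
    and "projects_to q p"
  shows "isomorphic_subspaces
           {u. infinitesimal_motion E p u \<and> symmetric_motion S p u}
           {u. sphere_motion E q u \<and> symmetric_motion (star ` S) (cone_config q) u}
       \<and> isomorphic_subspaces
           {u. trivial_motion E p u \<and> symmetric_motion S p u}
           {u. trivial_sphere_motion E q u \<and> symmetric_motion (star ` S) (cone_config q) u}
       \<and> ((\<exists>u. infinitesimal_motion E p u \<and> \<not> trivial_motion E p u \<and> symmetric_motion S p u)
          \<longleftrightarrow>
          (\<exists>u. sphere_motion E q u \<and> \<not> trivial_sphere_motion E q u
             \<and> symmetric_motion (star ` S) (cone_config q) u))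
       \<and> isomorphic_subspaces
           {\<omega>. self_stress E p \<omega> \<and> symmetric_stress S E p \<omega>}
           {\<omega>. self_stress (cone_graph E) (cone_config q) \<omega>
             \<and> symmetric_stress (star ` S) (cone_graph E) (cone_config q) \<omega>}"
proof -
  obtain \<alpha> where "\<And>i. \<alpha> i \<noteq> 0" "\<And>i. q $ i = \<alpha> i *\<^sub>R homogenize (p $ i)"
    using assms(5) unfolding projects_to_def by metis
  then interpret symmetric_projected_framework E p q \<alpha> S
    using assms by unfold_locales (simp_all add: symmetric_framework_def framework_def)
  have sym: "subspace {u. symmetric_motion S p u}"
    using linear_symmetry by (rule subspace_symmetric_motions)
  have "subspace {u. infinitesimal_motion E p u \<and> symmetric_motion S p u}"
    using subspace_inter[OF subspace_infinitesimal_motions sym] by (simp add: Int_def)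
  moreover have "subspace {u. trivial_motion E p u \<and> symmetric_motion S p u}"
    using subspace_inter[OF subspace_trivial_motions sym] by (simp add: Int_def)
  ultimately show ?thesis
    unfolding lift_symmetric_motions lift_symmetric_trivial_motions lift_symmetric_stresses
    by (intro conjI isomorphic_subspaces_image nontrivial_symmetric_motion_iff
        subspace_symmetric_stresses linear_lift_motion inj_lift_motion
        linear_lift_stress inj_lift_stress)
qed

end
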